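(* Let $n,m$ be positive integers. (i) If $n>\frac{(m-1)^2}{4}$, then $\kappa\left(\sqrt{n(n+m)}\right)=2n+m$. (ii) If $n>(m-1)^2+1$, then $$\kappa\left(\frac{n-m-1+\sqrt{(n-m-1)^2+4m(n-m)}}{2}\right)=n.$$
   Context: All graphs are finite simple graphs. The spectral radius $\lambda_1(G)$ of a graph $G$ is the largest eigenvalue of its adjacency matrix. For $\lambda\geq 0$, the spectral radius order $\kappa(\lambda)$ is the minimum number of vertices of a graph $G$ with $\lambda_1(G)=\lambda$; if no graph has spectral radius $\lambda$, then $\kappa(\lambda)=+\infty$. *)

theory Defs
  imports
    Complex_Main
    "HOL-Library.Extended_Nat"
    "Graph_Theory.Pair_Digraph"
    "Jordan_Normal_Form.Char_Poly"
begin

text \<open>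
  Finite simple graphs are those satisfying the locale predicate \<^const>\<open>pair_graph\<close>: finitely many
  vertices, no loops, and a symmetric arc relation, in which an edge \<open>{u, v}\<close> is represented by the
  two arcs \<open>(u, v)\<close> and \<open>(v, u)\<close>. Rows and columns of the adjacency matrix are indexed by the
  vertices in increasing order; another enumeration gives a permutation-similar matrix, with the
  same eigenvalues.
\<close>

definition adjacency_matrix :: "'a :: linorder pair_pre_digraph \<Rightarrow> real mat" where
  "adjacency_matrix G =
    (let vs = sorted_list_of_set (pverts G)
     in mat (card (pverts G)) (card (pverts G))
          (\<lambda>(i, j). if (vs ! i, vs ! j) \<in> parcs G then 1 else 0))"

text \<open>Only meaningful for graphs with at least one vertex: the empty matrix has no eigenvalue.\<close>

definition graph_spectral_radius :: "'a :: linorder pair_pre_digraph \<Rightarrow> real" where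
  "graph_spectral_radius G = Max {k. eigenvalue (adjacency_matrix G) k}"

text \<open>
  Every finite graph is isomorphic to one with vertices in \<^typ>\<open>nat\<close>, so it suffices to range over
  these. The infimum of the empty set is \<^term>\<open>\<infinity> :: enat\<close>.
\<close>

definition spectral_radius_order :: "real \<Rightarrow> enat" where
  "spectral_radius_order l =
    Inf {enat (card (pverts G)) | G :: nat pair_pre_digraph.
           pair_graph G \<and> pverts G \<noteq> {} \<and> graph_spectral_radius G = l}"

end

theory Submission
  imports Defs "Jordan_Normal_Form.Spectral_Radius"
begin

text \<open>
  The complete bipartite graph on parts of sizes \<open>n\<close> and \<open>n + m\<close>, respectively the complete graph on
  \<open>n\<close> vertices with the edges inside an \<open>m\<close>-set removed, has the required spectral radius \<open>l\<close>, since
  it has a positive eigenvector for \<open>l\<close>.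

  In (ii) the hypothesis says that \<open>l > n - 2\<close>, and a graph on \<open>N\<close> vertices has all its eigenvalues
  at most \<open>N - 1\<close>. In (i) it says that \<open>2 l\<close> lies strictly between \<open>2 n + m - 1\<close> and \<open>2 n + m\<close>.
  Hence \<open>l\<close> is a quadratic irrational whose conjugate \<open>- l\<close> is also an eigenvalue of every graph with
  spectral radius \<open>l\<close>, and the eigenvalues of a graph on \<open>N\<close> vertices are at least \<open>- N / 2\<close>.
\<close>

section \<open>Eigenvalues of matrices\<close>

lemma eigenvalue_iff_entries:
  fixes A :: "'a :: comm_ring_1 mat"
  assumes A: "A \<in> carrier_mat n n"
  shows "eigenvalue A k \<longleftrightarrow>
    (\<exists>f. (\<exists>i<n. f i \<noteq> 0) \<and> (\<forall>i<n. (\<Sum>j<n. A $$ (i, j) * f j) = k * f i))"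
proof
  assume "eigenvalue A k"
  then obtain v where v: "v \<in> carrier_vec n" "v \<noteq> 0\<^sub>v n" "A *\<^sub>v v = k \<cdot>\<^sub>v v"
    using A unfolding eigenvalue_def eigenvector_def by auto
  have "\<exists>i<n. v $ i \<noteq> 0"
    using v(1,2) by (metis carrier_vecD eq_vecI index_zero_vec(1) index_zero_vec(2))
  moreover have "(\<Sum>j<n. A $$ (i, j) * v $ j) = k * v $ i" if "i < n" for i
  proof -
    have "(A *\<^sub>v v) $ i = (k \<cdot>\<^sub>v v) $ i" using v(3) by simp
    then show ?thesis
      using A v(1) that by (simp add: scalar_prod_def atLeast0LessThan)
  qed
  ultimately show "\<exists>f. (\<exists>i<n. f i \<noteq> 0) \<and> (\<forall>i<n. (\<Sum>j<n. A $$ (i, j) * f j) = k * f i)"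
    by (intro exI[of _ "\<lambda>i. v $ i"]) auto
next
  assume "\<exists>f. (\<exists>i<n. f i \<noteq> 0) \<and> (\<forall>i<n. (\<Sum>j<n. A $$ (i, j) * f j) = k * f i)"
  then obtain f i where f: "\<forall>i<n. (\<Sum>j<n. A $$ (i, j) * f j) = k * f i" and i: "i < n" "f i \<noteq> 0"
    by blast
  have "A *\<^sub>v vec n f = k \<cdot>\<^sub>v vec n f"
    using A f by (intro eq_vecI) (auto simp: scalar_prod_def atLeast0LessThan)
  moreover have "vec n f \<noteq> 0\<^sub>v n"
    using i by (metis index_vec index_zero_vec(1))
  ultimately show "eigenvalue A k"
    using A unfolding eigenvalue_def eigenvector_def by (intro exI[of _ "vec n f"]) auto
qed

lemma finite_eigenvalues:
  fixes A :: "'a :: field mat"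
  assumes "A \<in> carrier_mat n n"
  shows "finite {k. eigenvalue A k}"
  using card_finite_spectrum(1)[OF assms] by (simp add: spectrum_def)

text \<open>A complex eigenvalue \<open>z\<close> with eigenvector \<open>a + i b\<close> exists by
  algebraic closedness. Evaluating the symmetric form on \<open>a\<close> and \<open>b\<close> in
  both orders yields \<open>Im z * (|a|\<^sup>2 + |b|\<^sup>2) = 0\<close>, so \<open>z\<close> is
  real, and whichever of \<open>a\<close>, \<open>b\<close> is nonzero is a real
  eigenvector.\<close>

lemma symmetric_real_mat_has_eigenvalue:
  fixes A :: "real mat"
  assumes A: "A \<in> carrier_mat n n" and n: "n > 0"
    and sym: "\<And>i j. i < n \<Longrightarrow> j < n \<Longrightarrow> A $$ (i, j) = A $$ (j, i)"
  shows "\<exists>k. eigenvalue A k"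
proof -
  let ?B = "map_mat complex_of_real A"
  have B: "?B \<in> carrier_mat n n" using A by simp
  from spectrum_non_empty[OF B n] obtain z where "eigenvalue ?B z"
    by (auto simp: spectrum_def)
  then obtain f i0 where i0: "i0 < n" "f i0 \<noteq> 0"
    and f: "\<And>i. i < n \<Longrightarrow> (\<Sum>j<n. ?B $$ (i, j) * f j) = z * f i"
    unfolding eigenvalue_iff_entries[OF B] by blast
  define a b r s where "a = (\<lambda>i. Re (f i))" and "b = (\<lambda>i. Im (f i))"
    and "r = Re z" and "s = Im z"
  have *: "(\<Sum>j<n. complex_of_real (A $$ (i, j)) * f j) = z * f i" if "i < n" for i
    using f[OF that] that A by simp
  have Aa: "(\<Sum>j<n. A $$ (i, j) * a j) = r * a i - s * b i" if "i < n" for i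
    using arg_cong[OF *[OF that], of Re] by (simp add: a_def b_def r_def s_def)
  have Ab: "(\<Sum>j<n. A $$ (i, j) * b j) = r * b i + s * a i" if "i < n" for i
    using arg_cong[OF *[OF that], of Im] by (simp add: a_def b_def r_def s_def)
  have "(\<Sum>i<n. b i * (\<Sum>j<n. A $$ (i, j) * a j)) = (\<Sum>i<n. \<Sum>j<n. b i * (A $$ (i, j) * a j))"
    by (simp add: sum_distrib_left)
  also have "\<dots> = (\<Sum>j<n. \<Sum>i<n. b i * (A $$ (i, j) * a j))"
    by (rule sum.swap)
  also have "\<dots> = (\<Sum>j<n. a j * (\<Sum>i<n. A $$ (j, i) * b i))"
    unfolding sum_distrib_left
    by (intro sum.cong refl) (simp add: sym mult_ac)
  finally have "(\<Sum>i<n. b i * (r * a i - s * b i)) = (\<Sum>i<n. a i * (r * b i + s * a i))"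
    by (simp add: Aa Ab)
  then have "(\<Sum>i<n. a i * (r * b i + s * a i) - b i * (r * a i - s * b i)) = 0"
    by (simp add: sum_subtractf)
  then have "s * (\<Sum>i<n. (a i)\<^sup>2 + (b i)\<^sup>2) = 0"
    by (simp add: sum_distrib_left algebra_simps power2_eq_square)
  moreover have "(\<Sum>i<n. (a i)\<^sup>2 + (b i)\<^sup>2) > 0"
  proof (rule sum_pos2)
    show "0 < (a i0)\<^sup>2 + (b i0)\<^sup>2"
      using i0 by (simp add: a_def b_def sum_power2_gt_zero_iff complex_eq_iff)
  qed (use i0 in auto)
  ultimately have s: "s = 0" by simp
  have "a i0 \<noteq> 0 \<or> b i0 \<noteq> 0"
    using i0 by (simp add: a_def b_def complex_eq_iff)
  then show ?thesis
  proof
    assume "a i0 \<noteq> 0"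
    then have "eigenvalue A r"
      unfolding eigenvalue_iff_entries[OF A] using Aa s i0(1) by (intro exI[of _ a]) auto
    then show ?thesis ..
  next
    assume "b i0 \<noteq> 0"
    then have "eigenvalue A r"
      unfolding eigenvalue_iff_entries[OF A] using Ab s i0(1) by (intro exI[of _ b]) auto
    then show ?thesis ..
  qed
qed

section \<open>Conjugate roots\<close>

text \<open>Even powers of \<open>s\<close> are integers and odd powers are integer multiples of
  \<open>s\<close>, so changing the sign of \<open>s\<close> only flips the second part. The
  induction is Horner's scheme.\<close>

lemma int_poly_at_sqrt:
  fixes p :: "int poly" and s :: real
  assumes s: "s\<^sup>2 = of_int d"
  shows "\<exists>a b :: int. poly (of_int_poly p) s = of_int a + of_int b * s \<and>
                    poly (of_int_poly p) (- s) = of_int a - of_int b * s"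
proof (induction p)
  case 0
  show ?case by (intro exI[of _ 0]) simp
next
  case (pCons c p)
  then obtain a b :: int where ab: "poly (of_int_poly p) s = of_int a + of_int b * s"
    "poly (of_int_poly p) (- s) = of_int a - of_int b * s" by blast
  have ss: "s * s = of_int d" using s by (simp add: power2_eq_square)
  have "s * (of_int b * s) = of_int (b * d)" by (simp add: ss[symmetric])
  then show ?case
    by (intro exI[of _ "c + b * d"] exI[of _ a])
      (simp add: ab of_int_hom.map_poly_pCons_hom algebra_simps)
qed

text \<open>In the form \<open>a + b s = 0\<close>, a nonzero \<open>b\<close> would give
  \<open>a\<^sup>2 = b\<^sup>2 d\<close>, hence \<open>b dvd a\<close>, and
  \<open>s = - a / b\<close> would be an integer. So \<open>a = b = 0\<close>, and the value at
  \<open>- s\<close> vanishes too.\<close>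

lemma int_poly_conjugate_root:
  fixes p :: "int poly" and s :: real
  assumes s: "s\<^sup>2 = of_int d" "s \<notin> \<int>" and root: "poly (of_int_poly p) s = 0"
  shows "poly (of_int_poly p) (- s) = 0"
proof -
  obtain a b :: int where ab: "poly (of_int_poly p) s = of_int a + of_int b * s"
    "poly (of_int_poly p) (- s) = of_int a - of_int b * s"
    using int_poly_at_sqrt[OF s(1)] by blast
  have eq: "of_int a = - (of_int b * s)" using ab(1) root by simp
  have "b = 0"
  proof (rule ccontr)
    assume b: "b \<noteq> 0"
    have "of_int (a\<^sup>2) = (of_int (b\<^sup>2 * d) :: real)"
      using eq s(1) by (simp add: power_mult_distrib)
    then have "b\<^sup>2 dvd a\<^sup>2" by (metis of_int_eq_iff dvd_triv_left)
    then have "b dvd a" by simp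
    then obtain c where "a = b * c" by (elim dvdE)
    then have "of_int b * s = of_int b * of_int (- c)" using eq by simp
    then have "s = of_int (- c)" using b unfolding mult_cancel_left by simp
    then show False using s(2) by (metis Ints_of_int)
  qed
  then show ?thesis using ab eq by simp
qed

section \<open>Eigenvalues of graphs\<close>

lemma adjacency_matrix_carrier:
  "adjacency_matrix G \<in> carrier_mat (card (pverts G)) (card (pverts G))"
  by (simp add: adjacency_matrix_def Let_def)

lemma adjacency_matrix_index:
  assumes "i < card (pverts G)" "j < card (pverts G)"
  shows "adjacency_matrix G $$ (i, j) =
    of_bool ((sorted_list_of_set (pverts G) ! i, sorted_list_of_set (pverts G) ! j) \<in> parcs G)"
  using assms by (simp add: adjacency_matrix_def Let_def)

text \<open>Removes the enumeration of the vertices: from here on eigenvectors are functions on the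
  vertex set.\<close>

lemma eigenvalue_adjacency_matrix_iff:
  assumes fin: "finite (pverts G)"
  shows "eigenvalue (adjacency_matrix G) k \<longleftrightarrow>
    (\<exists>f. (\<exists>v\<in>pverts G. f v \<noteq> 0) \<and>
         (\<forall>v\<in>pverts G. (\<Sum>u\<in>pverts G. of_bool ((v, u) \<in> parcs G) * f u) = k * f v))"
    (is "_ \<longleftrightarrow> (\<exists>f. ?P f)")
proof -
  define n where "n = card (pverts G)"
  define e where "e = (!) (sorted_list_of_set (pverts G))"
  define c where "c = the_inv_into {..<n} e"
  have bij: "bij_betw e {..<n} (pverts G)"
    unfolding e_def n_def by (rule bij_betw_nth) (use fin in auto)
  have c: "c (e i) = i" if "i < n" for i
    using that bij unfolding c_def by (simp add: the_inv_into_f_f bij_betw_imp_inj_on)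
  have verts: "pverts G = e ` {..<n}"
    using bij by (simp add: bij_betw_imp_surj_on)
  have sum: "(\<Sum>u\<in>pverts G. g u) = (\<Sum>j<n. g (e j))" for g :: "'a \<Rightarrow> real"
    using sum.reindex_bij_betw[OF bij, of g] by simp
  have entry: "adjacency_matrix G $$ (i, j) = of_bool ((e i, e j) \<in> parcs G)"
    if "i < n" "j < n" for i j
    using that unfolding n_def e_def by (rule adjacency_matrix_index)
  have "eigenvalue (adjacency_matrix G) k \<longleftrightarrow>
    (\<exists>h. (\<exists>i<n. h i \<noteq> 0) \<and> (\<forall>i<n. (\<Sum>j<n. of_bool ((e i, e j) \<in> parcs G) * h j) = k * h i))"
    (is "_ \<longleftrightarrow> (\<exists>h. ?Q h)")
    unfolding eigenvalue_iff_entries[OF adjacency_matrix_carrier] n_def[symmetric]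
    by (simp add: entry del: sum_of_bool_mult_eq sum_mult_of_bool_eq)
  also have "\<dots> \<longleftrightarrow> (\<exists>f. ?P f)"
  proof
    assume "\<exists>h. ?Q h"
    then obtain h where "?Q h" ..
    then have "?P (\<lambda>v. h (c v))"
      unfolding sum by (auto simp: verts c)
    then show "\<exists>f. ?P f" by (rule exI[where P = ?P])
  next
    assume "\<exists>f. ?P f"
    then obtain f where "?P f" ..
    then have "?Q (\<lambda>i. f (e i))"
      unfolding sum unfolding verts by auto
    then show "\<exists>h. ?Q h" by (rule exI[where P = ?Q])
  qed
  finally show ?thesis .
qed

text \<open>Symmetry of the arcs makes the set of real eigenvalues nonempty, so the
  \<open>Max\<close> in the definition is attained.\<close>

lemma eigenvalue_graph_spectral_radius:
  assumes "pair_graph G" "pverts G \<noteq> {}"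
  shows "eigenvalue (adjacency_matrix G) (graph_spectral_radius G)"
proof -
  interpret pair_graph G by fact
  let ?A = "adjacency_matrix G" and ?n = "card (pverts G)"
  have "?A $$ (i, j) = ?A $$ (j, i)" if "i < ?n" "j < ?n" for i j
    using that by (auto simp: adjacency_matrix_index intro: arcs_symmetric)
  moreover have "?n > 0"
    using assms(2) pair_finite_verts by (simp add: card_gt_0_iff)
  ultimately have "\<exists>k. eigenvalue ?A k"
    using symmetric_real_mat_has_eigenvalue[OF adjacency_matrix_carrier] by blast
  then show ?thesis
    using Max_in[OF finite_eigenvalues[OF adjacency_matrix_carrier, of G]]
    unfolding graph_spectral_radius_def by blast
qed

text \<open>Compare an eigenvector with \<open>y\<close> at a vertex maximising the ratio of absolute values.\<close>

lemma eigenvalue_le_of_positive_supersolution: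
  assumes fin: "finite (pverts G)" and ev: "eigenvalue (adjacency_matrix G) k"
    and pos: "\<And>v. v \<in> pverts G \<Longrightarrow> y v > 0"
    and sup: "\<And>v. v \<in> pverts G \<Longrightarrow>
      (\<Sum>u\<in>pverts G. of_bool ((v, u) \<in> parcs G) * y u) \<le> l * y v"
  shows "k \<le> l"
proof -
  let ?V = "pverts G"
  obtain f w where w: "w \<in> ?V" "f w \<noteq> 0"
    and f: "\<And>v. v \<in> ?V \<Longrightarrow> (\<Sum>u\<in>?V. of_bool ((v, u) \<in> parcs G) * f u) = k * f v"
    using ev unfolding eigenvalue_adjacency_matrix_iff[OF fin] by blast
  define q where "q = (\<lambda>v. \<bar>f v\<bar> / y v)"
  have "finite (q ` ?V)" "q ` ?V \<noteq> {}" using fin w by auto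
  from Max_in[OF this] obtain i where i: "i \<in> ?V" "q i = Max (q ` ?V)" by auto
  have le: "q v \<le> q i" if "v \<in> ?V" for v
    using that fin unfolding i(2) by (intro Max_ge) auto
  have "q w > 0" using w pos by (simp add: q_def)
  then have qi: "q i > 0" using le[OF w(1)] by simp
  have fi: "\<bar>f i\<bar> = q i * y i" using pos[OF i(1)] by (simp add: q_def)
  have fu: "\<bar>f u\<bar> \<le> q i * y u" if "u \<in> ?V" for u
    using le[OF that] pos[OF that] by (simp add: q_def field_simps)
  have "k * \<bar>f i\<bar> \<le> \<bar>k * f i\<bar>"
    by (simp add: abs_mult mult_right_mono)
  also have "\<dots> \<le> (\<Sum>u\<in>?V. \<bar>of_bool ((i, u) \<in> parcs G) * f u\<bar>)"
    unfolding f[OF i(1), symmetric] by (rule sum_abs)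
  also have "\<dots> \<le> (\<Sum>u\<in>?V. q i * (of_bool ((i, u) \<in> parcs G) * y u))"
    using fu by (intro sum_mono) auto
  also have "\<dots> \<le> q i * (l * y i)"
    unfolding sum_distrib_left[symmetric] using sup[OF i(1)] qi by (intro mult_left_mono) auto
  finally have "k * \<bar>f i\<bar> \<le> l * \<bar>f i\<bar>" by (simp add: fi mult_ac)
  moreover have "\<bar>f i\<bar> > 0" using fi qi pos[OF i(1)] by simp
  ultimately show ?thesis by simp
qed

text \<open>A positive eigenvector is itself a supersolution, so no eigenvalue exceeds its
  own.\<close>

lemma graph_spectral_radius_eqI:
  assumes fin: "finite (pverts G)" and ne: "pverts G \<noteq> {}"
    and pos: "\<And>v. v \<in> pverts G \<Longrightarrow> y v > 0"
    and eq: "\<And>v. v \<in> pverts G \<Longrightarrow>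
      (\<Sum>u\<in>pverts G. of_bool ((v, u) \<in> parcs G) * y u) = l * y v"
  shows "graph_spectral_radius G = l"
  unfolding graph_spectral_radius_def
proof (rule Max_eqI)
  show "finite {k. eigenvalue (adjacency_matrix G) k}"
    by (rule finite_eigenvalues[OF adjacency_matrix_carrier])
  show "k \<le> l" if "k \<in> {k. eigenvalue (adjacency_matrix G) k}" for k
    using that eigenvalue_le_of_positive_supersolution[OF fin _ pos, of k _ l] eq by simp
  obtain v where v: "v \<in> pverts G" using ne by blast
  then show "l \<in> {k. eigenvalue (adjacency_matrix G) k}"
    unfolding mem_Collect_eq eigenvalue_adjacency_matrix_iff[OF fin]
    using eq pos[OF v] by (intro exI[of _ y] conjI bexI[of _ v] ballI) auto
qed

text \<open>The constant function 1 is a supersolution, since a vertex is adjacent to at most all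
  the others.\<close>

lemma eigenvalue_le_card_minus_one:
  assumes "pair_graph G" and ev: "eigenvalue (adjacency_matrix G) k"
  shows "k \<le> real (card (pverts G)) - 1"
proof -
  interpret pair_graph G by fact
  show ?thesis
  proof (rule eigenvalue_le_of_positive_supersolution[OF pair_finite_verts ev, of "\<lambda>_. 1"])
    fix v assume v: "v \<in> pverts G"
    have "(\<Sum>u\<in>pverts G. of_bool ((v, u) \<in> parcs G) * (1 :: real)) \<le>
        (\<Sum>u\<in>pverts G. of_bool (u \<noteq> v))"
      using pair_no_loops by (intro sum_mono) force
    also have "\<dots> = (\<Sum>u\<in>pverts G - {v}. 1)"
      using v pair_finite_verts by (subst sum.remove[of _ v]) auto
    also have "\<dots> = real (card (pverts G)) - 1"
      using v pair_finite_verts card_gt_0_iff[of "pverts G"] by (auto simp: of_nat_diff Suc_le_eq)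
    finally show "(\<Sum>u\<in>pverts G. of_bool ((v, u) \<in> parcs G) * (1 :: real)) \<le>
        (real (card (pverts G)) - 1) * 1" by simp
  qed simp
qed

text \<open>
  Let \<open>P\<close> and \<open>Q\<close> be the sets where an eigenvector for \<open>- k\<close> is positive and negative, and \<open>p\<close>, \<open>q\<close>
  its absolute mass there. The eigenvalue equation, summed over \<open>P\<close> and over \<open>Q\<close>, yields
  \<open>k p \<le> |P| q\<close> and \<open>k q \<le> |Q| p\<close>, so \<open>k\<^sup>2 \<le> |P| |Q|\<close>.
\<close>

lemma eigenvalue_ge_minus_half_card:
  assumes fin: "finite (pverts G)" and ev: "eigenvalue (adjacency_matrix G) (- k)"
  shows "2 * k \<le> real (card (pverts G))"
proof (cases "k > 0")
  case False
  then show ?thesis by simp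
next
  case k: True
  let ?V = "pverts G"
  have half: "k * sum g {v \<in> ?V. g v > 0} \<le>
      real (card {v \<in> ?V. g v > 0}) * sum (\<lambda>v. - g v) {v \<in> ?V. g v < 0}"
    if g: "\<And>v. v \<in> ?V \<Longrightarrow> (\<Sum>u\<in>?V. of_bool ((v, u) \<in> parcs G) * g u) = - k * g v" for g
  proof -
    \<comment> \<open>In \<open>k * g v\<close>, the sum of \<open>- g u\<close> over the neighbours
      \<open>u\<close> of \<open>v\<close>, omit the terms with \<open>g u \<ge> 0\<close> and add
      all missing vertices with \<open>g u < 0\<close>; neither decreases it.\<close>
    have "k * g v \<le> sum (\<lambda>v. - g v) {v \<in> ?V. g v < 0}" if "v \<in> ?V" for v
    proof -
      have "k * g v = (\<Sum>u\<in>?V. - (of_bool ((v, u) \<in> parcs G) * g u))"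
        using g[OF that] by (simp add: sum_negf)
      also have "\<dots> \<le> (\<Sum>u\<in>?V. if g u < 0 then - g u else 0)"
        by (intro sum_mono) auto
      also have "\<dots> = sum (\<lambda>v. - g v) {v \<in> ?V. g v < 0}"
        using fin by (simp add: sum.inter_filter)
      finally show ?thesis .
    qed
    then show ?thesis
      unfolding sum_distrib_left[of k] by (intro sum_bounded_above) auto
  qed
  obtain f w where w: "w \<in> ?V" "f w \<noteq> 0"
    and f: "\<And>v. v \<in> ?V \<Longrightarrow> (\<Sum>u\<in>?V. of_bool ((v, u) \<in> parcs G) * f u) = - k * f v"
    using ev unfolding eigenvalue_adjacency_matrix_iff[OF fin] by blast
  define P Q where "P = {v \<in> ?V. f v > 0}" and "Q = {v \<in> ?V. f v < 0}"
  define p q where "p = sum f P" and "q = sum (\<lambda>v. - f v) Q"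
  define a b where "a = real (card P)" and "b = real (card Q)"
  have finPQ: "finite P" "finite Q" using fin by (auto simp: P_def Q_def)
  have 1: "k * p \<le> a * q"
    using half[OF f] by (simp add: p_def q_def P_def Q_def a_def)
  \<comment> \<open>Passing to \<open>- f\<close> swaps the roles of \<open>P\<close> and
    \<open>Q\<close>.\<close>
  have 2: "k * q \<le> b * p"
    using half[of "\<lambda>v. - f v"] f by (simp add: p_def q_def P_def Q_def b_def sum_negf)
  have p0: "p \<ge> 0" unfolding p_def by (intro sum_nonneg) (auto simp: P_def)
  have q0: "q \<ge> 0" unfolding q_def by (intro sum_nonneg) (auto simp: Q_def)
  have ab0: "a \<ge> 0" "b \<ge> 0" by (auto simp: a_def b_def)
  have "p > 0 \<or> q > 0"
  proof (cases "f w > 0")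
    case True
    then have "p > 0" unfolding p_def
      using finPQ w by (intro sum_pos2[of _ w]) (auto simp: P_def)
    then show ?thesis ..
  next
    case False
    then have "q > 0" unfolding q_def
      using finPQ w by (intro sum_pos2[of _ w]) (auto simp: Q_def)
    then show ?thesis ..
  qed
  \<comment> \<open>As \<open>k > 0\<close>, neither mass can vanish alone; this makes
    \<open>p * q\<close> positive, so that it can be cancelled from the product of \<open>1\<close>
    and \<open>2\<close>.\<close>
  moreover have "q > 0" if "p > 0"
  proof -
    have "0 < a * q" using 1 k that by (smt (verit) mult_pos_pos)
    then show ?thesis using q0 by (cases "q = 0") auto
  qed
  moreover have "p > 0" if "q > 0"
  proof -
    have "0 < b * p" using 2 k that by (smt (verit) mult_pos_pos)
    then show ?thesis using p0 by (cases "p = 0") auto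
  qed
  ultimately have pq: "p * q > 0" by auto
  have "(k * p) * (k * q) \<le> (a * q) * (b * p)"
    using k p0 q0 ab0 by (intro mult_mono[OF 1 2]) auto
  then have "k\<^sup>2 * (p * q) \<le> (a * b) * (p * q)"
    by (simp add: power2_eq_square mult_ac)
  then have "k\<^sup>2 \<le> a * b" using pq by (simp add: mult_le_cancel_right)
  \<comment> \<open>The inequality of arithmetic and geometric means, from
    \<open>(a - b)\<^sup>2 \<ge> 0\<close>.\<close>
  then have "(2 * k)\<^sup>2 \<le> (a + b)\<^sup>2"
    using zero_le_power2[of "a - b"] by (simp add: power2_eq_square algebra_simps)
  then have "2 * k \<le> a + b" by (rule power2_le_imp_le) (use ab0 in simp)
  also have "a + b = real (card (P \<union> Q))"
    using finPQ by (subst card_Un_disjoint) (auto simp: a_def b_def P_def Q_def)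
  also have "\<dots> \<le> real (card ?V)"
    using fin by (intro of_nat_mono card_mono) (auto simp: P_def Q_def)
  finally show ?thesis .
qed

text \<open>The characteristic polynomial has integer coefficients, so its root \<open>k\<close>
  brings the conjugate \<open>- k\<close> along.\<close>

lemma eigenvalue_adjacency_matrix_conjugate:
  assumes k: "k\<^sup>2 = of_int d" "k \<notin> \<int>" and ev: "eigenvalue (adjacency_matrix G) k"
  shows "eigenvalue (adjacency_matrix G) (- k)"
proof -
  let ?n = "card (pverts G)"
  \<comment> \<open>The entries are 0 or 1, so \<open>floor\<close> merely changes their
    type.\<close>
  define B :: "int mat" where "B = map_mat floor (adjacency_matrix G)"
  have B: "B \<in> carrier_mat ?n ?n"
    by (simp add: B_def adjacency_matrix_carrier)
  have AB: "adjacency_matrix G = map_mat of_int B"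
    using adjacency_matrix_carrier[of G]
    by (intro eq_matI) (auto simp: B_def adjacency_matrix_index)
  have "char_poly (adjacency_matrix G) = of_int_poly (char_poly B)"
    unfolding AB by (rule of_int_hom.char_poly_hom[OF B])
  then show ?thesis
    using int_poly_conjugate_root[OF k, of "char_poly B"] ev
    by (simp add: eigenvalue_root_char_poly[OF adjacency_matrix_carrier])
qed

section \<open>The spectral radius order\<close>

text \<open>Since a spectral radius is an eigenvalue, minimality may be tested on all graphs with
  eigenvalue \<open>l\<close>, the form in which the eigenvalue bounds apply.\<close>

lemma spectral_radius_order_eqI:
  fixes G :: "nat pair_pre_digraph"
  assumes "pair_graph G" "pverts G \<noteq> {}" "graph_spectral_radius G = l" "card (pverts G) = n"
    and "\<And>H :: nat pair_pre_digraph. pair_graph H \<Longrightarrow>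
      eigenvalue (adjacency_matrix H) l \<Longrightarrow> n \<le> card (pverts H)"
  shows "spectral_radius_order l = enat n"
proof (rule antisym)
  show "spectral_radius_order l \<le> enat n"
    unfolding spectral_radius_order_def using assms(1-4) by (intro Inf_lower) blast
  show "enat n \<le> spectral_radius_order l"
    unfolding spectral_radius_order_def
    using assms(5) eigenvalue_graph_spectral_radius by (intro Inf_greatest) fastforce
qed

lemma pair_graphI:
  assumes "finite V" "E \<subseteq> V \<times> V" "sym E" "irrefl E"
  shows "pair_graph \<lparr>pverts = V, parcs = E\<rparr>"
proof -
  have "finite E" using assms(1,2) by (meson finite_SigmaI finite_subset)
  then show ?thesis
    using assms by unfold_locales (auto simp: symmetric_def irrefl_def)
qed

section \<open>The extremal graphs and their spectral radii\<close>

definition complete_bipartite :: "nat \<Rightarrow> nat \<Rightarrow> nat pair_pre_digraph" where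
  "complete_bipartite a b =
    \<lparr>pverts = {..<a + b},
     parcs = {(i, j). i < a + b \<and> j < a + b \<and> (i < a) \<noteq> (j < a)}\<rparr>"

definition complete_split :: "nat \<Rightarrow> nat \<Rightarrow> nat pair_pre_digraph" where
  "complete_split m c =
    \<lparr>pverts = {..<m + c},
     parcs = {(i, j). i < m + c \<and> j < m + c \<and> i \<noteq> j \<and> \<not> (i < m \<and> j < m)}\<rparr>"

lemma pair_graph_complete_bipartite: "pair_graph (complete_bipartite a b)"
  unfolding complete_bipartite_def by (rule pair_graphI) (auto simp: sym_def irrefl_def)

lemma pair_graph_complete_split: "pair_graph (complete_split m c)"
  unfolding complete_split_def by (rule pair_graphI) (auto simp: sym_def irrefl_def)

lemma sum_lessThan_add_split:
  fixes g :: "nat \<Rightarrow> 'a :: comm_monoid_add"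
  shows "(\<Sum>u<a + b. g u) = (\<Sum>u<a. g u) + (\<Sum>u=a..<a + b. g u)"
  using sum.atLeastLessThan_concat[of 0 a "a + b" g] by (simp add: atLeast0LessThan)

lemma graph_spectral_radius_complete_bipartite:
  assumes "a > 0" "b > 0"
  shows "graph_spectral_radius (complete_bipartite a b) = sqrt (real a * real b)"
proof (rule graph_spectral_radius_eqI[where y = "\<lambda>v. if v < a then sqrt b else sqrt a"])
  let ?G = "complete_bipartite a b" and ?y = "\<lambda>v. if v < a then sqrt (real b) else sqrt (real a)"
  fix v assume "v \<in> pverts ?G"
  then have v: "v < a + b" by (simp add: complete_bipartite_def)
  have "(\<Sum>u\<in>pverts ?G. of_bool ((v, u) \<in> parcs ?G) * ?y u) =
      (\<Sum>u<a + b. of_bool ((v < a) \<noteq> (u < a)) * ?y u)"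
    using v by (intro sum.cong) (auto simp: complete_bipartite_def)
  also have "\<dots> = (\<Sum>u<a. of_bool (\<not> v < a) * sqrt (real b)) +
      (\<Sum>u=a..<a + b. of_bool (v < a) * sqrt (real a))"
    unfolding sum_lessThan_add_split by (intro arg_cong2[of _ _ _ _ "(+)"] sum.cong) auto
  also have "\<dots> = sqrt (real a * real b) * ?y v"
    by (simp add: real_sqrt_mult mult_ac)
  finally show "(\<Sum>u\<in>pverts ?G. of_bool ((v, u) \<in> parcs ?G) * ?y u) =
      sqrt (real a * real b) * ?y v" .
qed (use assms in \<open>auto simp: complete_bipartite_def lessThan_empty_iff\<close>)

text \<open>Give weight \<open>c\<close> to the \<open>m\<close> independent vertices and
  \<open>l\<close> to the \<open>c\<close> clique vertices. The equation at an independent vertex is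
  \<open>c * l = l * c\<close>; at a clique vertex it is the assumed quadratic equation.\<close>

lemma graph_spectral_radius_complete_split:
  assumes c: "c > 0" and l: "l > 0" "l\<^sup>2 = (real c - 1) * l + real m * real c"
  shows "graph_spectral_radius (complete_split m c) = l"
proof (rule graph_spectral_radius_eqI[where y = "\<lambda>v. if v < m then real c else l"])
  let ?G = "complete_split m c" and ?y = "\<lambda>v. if v < m then real c else l"
  fix v assume "v \<in> pverts ?G"
  then have v: "v < m + c" by (simp add: complete_split_def)
  have "(\<Sum>u\<in>pverts ?G. of_bool ((v, u) \<in> parcs ?G) * ?y u) =
      (\<Sum>u<m + c. of_bool (v \<noteq> u \<and> \<not> (v < m \<and> u < m)) * ?y u)"
    using v by (intro sum.cong) (auto simp: complete_split_def)
  also have "\<dots> = (\<Sum>u<m. of_bool (\<not> v < m) * real c) + (\<Sum>u=m..<m + c. of_bool (u \<noteq> v) * l)"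
    unfolding sum_lessThan_add_split by (intro arg_cong2[of _ _ _ _ "(+)"] sum.cong) auto
  \<comment> \<open>A clique vertex meets every clique vertex but itself, so one \<open>l\<close> is
    subtracted exactly when \<open>v\<close> lies in the clique.\<close>
  also have "(\<Sum>u=m..<m + c. of_bool (u \<noteq> v) * l) = (\<Sum>u=m..<m + c. l - (if u = v then l else 0))"
    by (intro sum.cong) auto
  also have "\<dots> = real c * l - (if v < m then 0 else l)"
    using v by (simp add: sum_subtractf)
  also have "(\<Sum>u<m. of_bool (\<not> v < m) * real c) + (real c * l - (if v < m then 0 else l)) = l * ?y v"
    using l(2) by (simp add: power2_eq_square algebra_simps)
  finally show "(\<Sum>u\<in>pverts ?G. of_bool ((v, u) \<in> parcs ?G) * ?y u) = l * ?y v" .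
qed (use assms in \<open>auto simp: complete_split_def lessThan_empty_iff\<close>)

section \<open>Matching the extremal graphs with the eigenvalue bounds\<close>

theorem theorem1p5:
  fixes n m :: nat
  assumes "n > 0" and "m > 0"
  shows "(real n > (real m - 1)\<^sup>2 / 4 \<longrightarrow>
            spectral_radius_order (sqrt (real n * (real n + real m))) = enat (2 * n + m)) \<and>
         (real n > (real m - 1)\<^sup>2 + 1 \<longrightarrow>
            spectral_radius_order
              ((real n - real m - 1
                + sqrt ((real n - real m - 1)\<^sup>2 + 4 * real m * (real n - real m))) / 2) = enat n)"
proof (intro conjI impI)
  assume nm: "real n > (real m - 1)\<^sup>2 / 4"
  define l where "l = sqrt (real n * (real n + real m))"
  have l0: "l \<ge> 0" by (simp add: l_def)
  have l2: "l\<^sup>2 = real n * (real n + real m)" by (simp add: l_def)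
  \<comment> \<open>As \<open>(2 n + m)\<^sup>2 - (2 l)\<^sup>2 = m\<^sup>2\<close>, squaring turns
    this into \<open>(m - 1)\<^sup>2 < 4 n\<close>, the hypothesis.\<close>
  have lower: "2 * real n + real m - 1 < 2 * l"
  proof (rule power2_less_imp_less)
    show "(2 * real n + real m - 1)\<^sup>2 < (2 * l)\<^sup>2"
      using nm by (simp add: power_mult_distrib l2) (simp add: power2_eq_square algebra_simps)
  qed (use l0 in simp)
  have upper: "2 * l < 2 * real n + real m"
  proof (rule power2_less_imp_less)
    show "(2 * l)\<^sup>2 < (2 * real n + real m)\<^sup>2"
      using assms by (simp add: power_mult_distrib l2) (simp add: power2_eq_square algebra_simps)
  qed simp
  \<comment> \<open>Otherwise \<open>2 l\<close> would be an integer strictly between two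
    consecutive integers.\<close>
  have "l \<notin> \<int>"
  proof
    assume "l \<in> \<int>"
    then obtain z where "l = of_int z" by (elim Ints_cases)
    then have "of_int (2 * int n + int m - 1) < (of_int (2 * z) :: real)"
      "(of_int (2 * z) :: real) < of_int (2 * int n + int m)"
      using lower upper by simp_all
    then show False unfolding of_int_less_iff by linarith
  qed
  moreover have "l\<^sup>2 = of_int (int n * (int n + int m))" by (simp add: l2)
  ultimately have conj: "eigenvalue (adjacency_matrix H) (- l)"
    if "eigenvalue (adjacency_matrix H) l" for H :: "nat pair_pre_digraph"
    using that eigenvalue_adjacency_matrix_conjugate by blast
  show "spectral_radius_order (sqrt (real n * (real n + real m))) = enat (2 * n + m)"
    unfolding l_def[symmetric]
  proof (rule spectral_radius_order_eqI[OF pair_graph_complete_bipartite])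
    show "graph_spectral_radius (complete_bipartite n (n + m)) = l"
      using graph_spectral_radius_complete_bipartite[of n "n + m"] assms by (simp add: l_def)
    fix H :: "nat pair_pre_digraph"
    assume H: "pair_graph H" and ev: "eigenvalue (adjacency_matrix H) l"
    interpret pair_graph H by fact
    have "2 * l \<le> real (card (pverts H))"
      by (rule eigenvalue_ge_minus_half_card[OF pair_finite_verts conj[OF ev]])
    with lower have "real (2 * n + m) < real (card (pverts H) + 1)" by simp
    then show "2 * n + m \<le> card (pverts H)" unfolding of_nat_less_iff by simp
  qed (use assms in \<open>auto simp: complete_bipartite_def lessThan_empty_iff\<close>)
next
  assume nm: "real n > (real m - 1)\<^sup>2 + 1"
  \<comment> \<open>The discriminant of \<open>l\<^sup>2 = (c - 1) l + m c\<close> for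
    \<open>c = n - m\<close>; \<open>l\<close> is its larger root.\<close>
  define D where "D = (real n - real m - 1)\<^sup>2 + 4 * real m * (real n - real m)"
  define l where "l = (real n - real m - 1 + sqrt D) / 2"
  \<comment> \<open>The difference of the sides is \<open>(m - 1) (m - 2)\<close>, nonnegative at
    integers. It yields \<open>m < n\<close>, so the clique part of size \<open>n - m\<close> is
    nonempty.\<close>
  have "(real m - 1)\<^sup>2 + 1 \<ge> real m"
  proof (cases "m = 1")
    case False
    then have "(real m - 1) * (real m - 2) \<ge> 0" using assms by (intro mult_nonneg_nonneg) auto
    then show ?thesis by (simp add: power2_eq_square algebra_simps)
  qed simp
  then have mn: "m < n" using nm by simp
  have "4 * real m * (real n - real m) > 0" using mn assms by simp
  then have D: "D > (real n - real m - 1)\<^sup>2" "D \<ge> 0"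
    unfolding D_def by (auto intro: add_nonneg_nonneg)
  have "\<bar>real n - real m - 1\<bar> < sqrt D" using D(1) by (simp add: real_less_rsqrt)
  then have l0: "l > 0" by (simp add: l_def)
  have "2 * l - (real n - real m - 1) = sqrt D" by (simp add: l_def field_simps)
  then have "(2 * l - (real n - real m - 1))\<^sup>2 = D" using D(2) by simp
  then have l2: "l\<^sup>2 = (real (n - m) - 1) * l + real m * real (n - m)"
    using mn by (simp add: D_def of_nat_diff power2_eq_square algebra_simps)
  have lower: "l > real n - 2"
  proof -
    \<comment> \<open>\<open>D - (n + m - 3)\<^sup>2\<close> equals
      \<open>4 (n - (m - 1)\<^sup>2 - 1)\<close>, positive by hypothesis.\<close>
    have "(real n + real m - 3)\<^sup>2 < D"
      using nm by (simp add: D_def power2_eq_square algebra_simps)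
    then have "real n + real m - 3 < sqrt D" by (rule real_less_rsqrt)
    then show ?thesis by (simp add: l_def)
  qed
  have "spectral_radius_order l = enat n"
  proof (rule spectral_radius_order_eqI[OF pair_graph_complete_split])
    show "graph_spectral_radius (complete_split m (n - m)) = l"
      using graph_spectral_radius_complete_split[OF _ l0 l2] mn by simp
    fix H :: "nat pair_pre_digraph"
    assume "pair_graph H" and "eigenvalue (adjacency_matrix H) l"
    then have "l \<le> real (card (pverts H)) - 1" by (rule eigenvalue_le_card_minus_one)
    with lower have "real n < real (card (pverts H) + 1)" by simp
    then show "n \<le> card (pverts H)" unfolding of_nat_less_iff by simp
  qed (use mn in \<open>auto simp: complete_split_def lessThan_empty_iff\<close>)
  then show "spectral_radius_order
      ((real n - real m - 1
        + sqrt ((real n - real m - 1)\<^sup>2 + 4 * real m * (real n - real m))) / 2) = enat n"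
    by (simp add: l_def D_def)
qed

end
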